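(* Let $p$ be a complex polynomial of degree $d\geq 2$. Assume that $p$ satisfies one of the following conditions: (a) $d=2$; or (b) $p$ can be written in the form $p(z)=p_{n,\beta}(z):=z^n-\beta$ for some integer $n\geq 3$ and some $\beta\in\mathbb C$. Suppose that $p(\alpha)=0$ and consider the damped Traub map $T_{p,\delta}$ with $\delta\in[0,1]$. Then the immediate basin of attraction $\mathcal A_\delta^{\star}(\alpha)$ of $\alpha$ under $T_{p,\delta}$ is a simply connected, unbounded set.
   Context: For a polynomial $p$ of degree $d\ge 2$, Newton's map is the rational map $N_p(z)=z-\frac{p(z)}{p'(z)}$. For a parameter $\delta\in\mathbb C$, the damped Traub map is the rational map $T_{p,\delta}:\hat{\mathbb C}\to\hat{\mathbb C}$ given by $$T_{p,\delta}(z)=N_p(z)-\delta\,\frac{p(N_p(z))}{p'(z)}$$ (understood after cancelling common factors and extended to the Riemann sphere $\hat{\mathbb C}$). A fixed point $\xi$ of a rational map $R$ is attracting if $|R'(\xi)|<1$. If $\xi$ is an attracting fixed point of $R$, its basin of attraction is $\mathcal A(\xi)=\{z\in\hat{\mathbb C} : R^m(z)\to\xi \text{ as } m\to\infty\}$, and its immediate basin of attraction $\mathcal A^{\star}(\xi)$ is the connected component of $\mathcal A(\xi)$ containing $\xi$. The notation $\mathcal A_\delta^{\star}(\alpha)$ denotes the immediate basin for $R=T_{p,\delta}$. *)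

theory Defs
  imports "HOL-Analysis.Analysis" "HOL-Computational_Algebra.Polynomial_Factorial"
    "HOL-Computational_Algebra.Field_as_Ring"
begin

text \<open>
  The Riemann sphere is the one-point compactification of the complex plane:
  \<^term>\<open>Some z\<close> is the finite point \<^term>\<open>z\<close> and \<^term>\<open>None\<close> is the point at infinity.
\<close>

instantiation option :: (topological_space) topological_space
begin

definition open_option :: "'a option set \<Rightarrow> bool" where
  "open_option U \<longleftrightarrow> openin (Alexandroff_compactification euclidean) U"

instance
proof
  have top: "topspace (Alexandroff_compactification (euclidean :: 'a topology)) = UNIV"
    by (auto simp: UNIV_option_conv)
  show "open (UNIV :: 'a option set)"
    unfolding open_option_def by (metis openin_topspace top)
qed (auto simp: open_option_def)

end

type_synonym riemann_sphere = "complex option"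

lemma open_riemann_sphere_iff:
  fixes U :: "riemann_sphere set"
  shows "open U \<longleftrightarrow> open (Some -` U) \<and> (None \<in> U \<longrightarrow> bounded (- (Some -` U)))"
proof -
  have img: "Some ` (Some -` U) = (if None \<in> U then U - {None} else U)"
    by (auto simp: image_iff) (metis not_Some_eq)+
  show ?thesis
  proof (cases "None \<in> U")
    case True
    then have U: "U = insert None (Some ` (- (- (Some -` U))))"
      using img by auto
    have "open U \<longleftrightarrow> (\<exists>C. compact C \<and> U = insert None (Some ` (- C)))"
      using True
      by (auto simp: open_option_def openin_Alexandroff_compactification
            compactin_euclidean_iff Compl_eq_Diff_UNIV[symmetric] intro: compact_imp_closed)
    also have "\<dots> \<longleftrightarrow> compact (- (Some -` U))"
    proof
      assume "\<exists>C. compact C \<and> U = insert None (Some ` (- C))"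
      then obtain C where C: "compact C" "U = insert None (Some ` (- C))" by blast
      then have "- (Some -` U) = C" by auto
      with C show "compact (- (Some -` U))" by simp
    qed (use U in blast)
    finally show ?thesis
      using True by (auto simp: compact_eq_bounded_closed closed_def)
  next
    case False
    then have "open U \<longleftrightarrow> (\<exists>V. open V \<and> U = Some ` V)"
      by (auto simp: open_option_def openin_Alexandroff_compactification)
    also have "\<dots> \<longleftrightarrow> open (Some -` U)"
    proof
      assume "\<exists>V. open V \<and> U = Some ` V"
      then obtain V where V: "open V" "U = Some ` V" by blast
      then have "Some -` U = V" by auto
      with V show "open (Some -` U)" by simp
    qed (use img False in metis)
    finally show ?thesis
      using False by simp
  qed
qed

type_synonym rat_fun = "complex poly fract"

text \<open>
  \<^term>\<open>quot_of_fract f\<close> is the reduced representation of \<^term>\<open>f\<close>: coprime numerator and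
  denominator, the denominator being monic. The value at infinity is the limit at infinity.
\<close>

definition rational_map :: "rat_fun \<Rightarrow> riemann_sphere \<Rightarrow> riemann_sphere" where
  "rational_map f w =
     (let (P, Q) = quot_of_fract f in
      case w of
        Some z \<Rightarrow> if poly Q z = 0 then None else Some (poly P z / poly Q z)
      | None \<Rightarrow> if degree Q < degree P then None
                else Some (coeff P (degree Q) / lead_coeff Q))"

definition const_fract :: "complex \<Rightarrow> rat_fun" where
  "const_fract c = to_fract [:c:]"

text \<open>Composition \<open>p \<circ> f\<close> of a polynomial with a rational function, as a rational function.\<close>

definition poly_comp_fract :: "complex poly \<Rightarrow> rat_fun \<Rightarrow> rat_fun" where
  "poly_comp_fract p f = poly (map_poly const_fract p) f"

definition newton :: "complex poly \<Rightarrow> rat_fun" where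
  "newton p = to_fract [:0, 1:] - to_fract p / to_fract (pderiv p)"

definition traub :: "complex poly \<Rightarrow> complex \<Rightarrow> rat_fun" where
  "traub p \<delta> =
     newton p - const_fract \<delta> * (poly_comp_fract p (newton p) / to_fract (pderiv p))"

abbreviation traub_map :: "complex poly \<Rightarrow> complex \<Rightarrow> riemann_sphere \<Rightarrow> riemann_sphere" where
  "traub_map p \<delta> \<equiv> rational_map (traub p \<delta>)"

definition basin :: "('a::topological_space \<Rightarrow> 'a) \<Rightarrow> 'a \<Rightarrow> 'a set" where
  "basin R \<xi> = {z. (\<lambda>m. (R ^^ m) z) \<longlonglongrightarrow> \<xi>}"

definition immediate_basin :: "('a::topological_space \<Rightarrow> 'a) \<Rightarrow> 'a \<Rightarrow> 'a set" where
  "immediate_basin R \<xi> = connected_component_set (basin R \<xi>) \<xi>"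

definition unbounded_in_plane :: "riemann_sphere set \<Rightarrow> bool" where
  "unbounded_in_plane A \<longleftrightarrow> \<not> bounded {z. Some z \<in> A}"

definition has_value :: "rat_fun \<Rightarrow> complex \<Rightarrow> complex \<Rightarrow> bool" where
  "has_value f z w \<longleftrightarrow>
     (\<exists>a b. f = to_fract a / to_fract b \<and> poly b z \<noteq> 0 \<and> w = poly a z / poly b z)"

lemma has_value_to_fract: "has_value (to_fract a) z (poly a z)"
  unfolding has_value_def by (rule exI[of _ a], rule exI[of _ 1]) auto

lemma has_value_divide:
  assumes "has_value f z w" "poly b z \<noteq> 0"
  shows "has_value (f / to_fract b) z (w / poly b z)"
proof -
  obtain a c where "f = to_fract a / to_fract c" "poly c z \<noteq> 0" "w = poly a z / poly c z"
    using assms(1) unfolding has_value_def by blast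
  with assms(2) show ?thesis
    unfolding has_value_def by (intro exI[of _ a] exI[of _ "c * b"]) auto
qed

lemma has_value_mult:
  assumes "has_value f z w" "has_value g z v"
  shows "has_value (f * g) z (w * v)"
proof -
  obtain a b c d where "f = to_fract a / to_fract b" "poly b z \<noteq> 0" "w = poly a z / poly b z"
    "g = to_fract c / to_fract d" "poly d z \<noteq> 0" "v = poly c z / poly d z"
    using assms unfolding has_value_def by blast
  then show ?thesis
    unfolding has_value_def by (intro exI[of _ "a * c"] exI[of _ "b * d"]) auto
qed

lemma has_value_add:
  assumes "has_value f z w" "has_value g z v"
  shows "has_value (f + g) z (w + v)"
proof -
  obtain a b c d where *: "f = to_fract a / to_fract b" "poly b z \<noteq> 0" "w = poly a z / poly b z"
    "g = to_fract c / to_fract d" "poly d z \<noteq> 0" "v = poly c z / poly d z"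
    using assms unfolding has_value_def by blast
  then have "b \<noteq> 0" "d \<noteq> 0" by auto
  with * show ?thesis
    unfolding has_value_def
    by (intro exI[of _ "a * d + c * b"] exI[of _ "b * d"]) (simp add: add_frac_eq mult.commute)
qed

lemma has_value_diff:
  assumes "has_value f z w" "has_value g z v"
  shows "has_value (f - g) z (w - v)"
proof -
  have "has_value (to_fract (- 1) * g) z (- v)"
    using has_value_mult[OF has_value_to_fract assms(2), of "- 1"] by simp
  from has_value_add[OF assms(1) this] show ?thesis by simp
qed

lemma has_value_poly_comp:
  assumes "has_value f z w"
  shows "has_value (poly_comp_fract p f) z (poly p w)"
proof (induction p)
  case 0
  show ?case using has_value_to_fract[of 0 z] by (simp add: poly_comp_fract_def)
next
  case (pCons a p)
  have "poly_comp_fract (pCons a p) f = const_fract a + f * poly_comp_fract p f"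
    by (cases "a = 0 \<and> p = 0")
      (auto simp: poly_comp_fract_def map_poly_pCons const_fract_def)
  moreover have "has_value (const_fract a) z a"
    using has_value_to_fract[of "[:a:]" z] by (simp add: const_fract_def)
  ultimately show ?case
    using has_value_add has_value_mult[OF assms pCons.IH] by simp
qed

lemma rational_map_has_value:
  assumes "has_value f z w"
  shows "rational_map f (Some z) = Some w"
proof -
  obtain a b where ab: "f = to_fract a / to_fract b" "poly b z \<noteq> 0" "w = poly a z / poly b z"
    using assms unfolding has_value_def by blast
  then have b0: "b \<noteq> 0" by auto
  have q: "quot_of_fract f = normalize_quot (a, b)"
    using ab(1) b0 by (simp add: Fract_conv_to_fract[symmetric] quot_of_fract_quot_to_fract[of "(a, b)", unfolded quot_to_fract_def, simplified])
  obtain d where "a = fst (normalize_quot (a, b)) * d" "b = snd (normalize_quot (a, b)) * d"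
    using normalize_quotE[OF b0, of a] by metis
  then have "poly a z = poly (fst (quot_of_fract f)) z * poly d z"
    "poly b z = poly (snd (quot_of_fract f)) z * poly d z"
    unfolding q by (metis poly_mult)+
  with ab show ?thesis
    by (auto simp: rational_map_def case_prod_unfold Let_def)
qed

lemma traub_map_eq:
  assumes "poly (pderiv p) z \<noteq> 0"
  defines "N \<equiv> z - poly p z / poly (pderiv p) z"
  shows "traub_map p \<delta> (Some z) = Some (N - \<delta> * (poly p N / poly (pderiv p) z))"
proof (rule rational_map_has_value)
  have N: "has_value (newton p) z N"
    unfolding newton_def N_def
    using has_value_diff[OF has_value_to_fract[of "[:0, 1:]"]
        has_value_divide[OF has_value_to_fract assms(1)]] by simp
  have "has_value (const_fract \<delta>) z \<delta>"
    using has_value_to_fract[of "[:\<delta>:]" z] by (simp add: const_fract_def)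
  then show "has_value (traub p \<delta>) z (N - \<delta> * (poly p N / poly (pderiv p) z))"
    unfolding traub_def
    by (intro has_value_diff has_value_mult has_value_divide has_value_poly_comp N assms(1))
qed

end

theory Submission
  imports Defs "HOL-Complex_Analysis.Complex_Analysis"
begin

text \<open>
  Up to an affine change of coordinates, \<open>p\<close> is \<open>z ^ n\<close> (where the Traub map is a linear
  contraction) or \<open>z ^ n - 1\<close> with \<open>\<alpha> = 1\<close>. In the latter case the Traub map commutes with the
  reflections of the regular \<open>n\<close>-gon, so the basin of \<open>1\<close> avoids the ray from \<open>0\<close> through
  \<open>exp (i \<pi> / n)\<close>. This ray joins the only finite pole \<open>0\<close> to infinity; hence the iterates of a
  filled loop in the immediate basin never meet the pole, and the maximum principle shows that the
  filled loop lies in the basin. On \<open>[1, \<infinity>)\<close> the Traub map lies between \<open>1\<close> and the Newton map, so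
  orbits decrease to \<open>1\<close> and the immediate basin contains this half-line.
\<close>

section \<open>Rational maps on the sphere from unreduced fractions, and homogenisation\<close>

lemma quot_of_fract_divideE:
  fixes a b :: "complex poly"
  assumes "b \<noteq> 0"
  obtains P Q d where "quot_of_fract (to_fract a / to_fract b) = (P, Q)"
    "a = P * d" "b = Q * d" "d \<noteq> 0"
proof -
  have q: "quot_of_fract (to_fract a / to_fract b) = normalize_quot (a, b)"
    using assms quot_of_fract_quot_to_fract[of "(a, b)"]
    by (simp add: Fract_conv_to_fract[symmetric] quot_to_fract_def)
  obtain d where "a = fst (normalize_quot (a, b)) * d" "b = snd (normalize_quot (a, b)) * d" "d \<noteq> 0"
    using normalize_quotE[OF assms, of a] by metis
  with q show thesis
    by (intro that[of "fst (normalize_quot (a, b))" "snd (normalize_quot (a, b))" d]) auto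
qed

text \<open>The numerator does not vanish at \<open>z\<close>, so neither does the cancelled factor
  \<open>d\<close>; the zero of \<open>b\<close> must survive in the reduced denominator.\<close>

lemma rational_map_pole:
  assumes "b \<noteq> 0" "poly b z = 0" "poly a z \<noteq> 0"
  shows "rational_map (to_fract a / to_fract b) (Some z) = None"
proof -
  obtain P Q d where "quot_of_fract (to_fract a / to_fract b) = (P, Q)" "a = P * d" "b = Q * d"
    using quot_of_fract_divideE[OF assms(1), of a] by metis
  with assms show ?thesis
    by (auto simp: rational_map_def)
qed

text \<open>Cancelling \<open>d\<close> lowers both degrees by the same amount, so they can be
  compared before reduction.\<close>

lemma rational_map_infinity:
  assumes "b \<noteq> 0" "degree b < degree a"
  shows "rational_map (to_fract a / to_fract b) None = None"
proof -
  obtain P Q d where *: "quot_of_fract (to_fract a / to_fract b) = (P, Q)" "a = P * d" "b = Q * d"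
    using quot_of_fract_divideE[OF assms(1), of a] by metis
  have "a \<noteq> 0" using assms by auto
  with * assms have "degree Q < degree P"
    by (auto simp: degree_mult_eq)
  with * show ?thesis
    by (auto simp: rational_map_def)
qed

lemma rational_map_to_fract:
  "rational_map (to_fract q) (Some z) = Some (poly q z)"
  by (simp add: rational_map_has_value has_value_to_fract)

text \<open>Homogenisation of \<open>p\<close>: \<open>p (q / r) = homog_eval p q r / r ^ degree p\<close>.\<close>

definition homog_eval :: "complex poly \<Rightarrow> complex poly \<Rightarrow> complex poly \<Rightarrow> complex poly" where
  "homog_eval p q r = (\<Sum>i\<le>degree p. smult (coeff p i) (q ^ i * r ^ (degree p - i)))"

lemma to_fract_power: "to_fract (x ^ n) = (to_fract x ^ n :: rat_fun)"
  by (induction n) auto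

lemma poly_comp_fract_altdef:
  "poly_comp_fract p f = (\<Sum>i\<le>degree p. const_fract (coeff p i) * f ^ i)"
proof -
  have "degree (map_poly const_fract p) = degree p"
    by (rule degree_map_poly) (simp add: const_fract_def)
  then show ?thesis
    by (simp add: poly_comp_fract_def poly_altdef coeff_map_poly const_fract_def)
qed

lemma poly_comp_fract_divide:
  assumes "r \<noteq> 0"
  shows "poly_comp_fract p (to_fract q / to_fract r) =
    to_fract (homog_eval p q r) / to_fract (r ^ degree p)"
proof -
  have "const_fract (coeff p i) * (to_fract q / to_fract r) ^ i =
      to_fract (smult (coeff p i) (q ^ i * r ^ (degree p - i))) / to_fract (r ^ degree p)"
    if "i \<le> degree p" for i
  proof -
    have "r ^ degree p = r ^ i * r ^ (degree p - i)"
      using that by (simp flip: power_add)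
    moreover have "smult c x = [:c:] * x" for c and x :: "complex poly"
      by simp
    ultimately show ?thesis
      using assms by (simp add: const_fract_def to_fract_power power_divide divide_simps
          del: mult_pCons_left)
  qed
  then show ?thesis
    by (simp add: poly_comp_fract_altdef homog_eval_def to_fract_sum sum_divide_distrib)
qed

lemma poly_comp_fract_to_fract:
  "poly_comp_fract p (to_fract q) = to_fract (pcompose p q)"
proof -
  have "smult c x = [:c:] * x" for c and x :: "complex poly"
    by simp
  then show ?thesis
    by (simp add: poly_comp_fract_altdef pcompose_altdef poly_altdef to_fract_sum to_fract_power 
          const_fract_def degree_map_poly coeff_map_poly del: mult_pCons_left)
qed

section \<open>The Newton and Traub maps as explicit fractions: poles and infinity\<close>

definition newton_num :: "complex poly \<Rightarrow> complex poly" where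
  "newton_num p = [:0, 1:] * pderiv p - p"

lemma newton_eq:
  assumes "pderiv p \<noteq> 0"
  shows "newton p = to_fract (newton_num p) / to_fract (pderiv p)"
  using assms
  by (simp add: newton_def newton_num_def to_fract_diff diff_divide_distrib del: mult_pCons_left)

text \<open>Numerator over the denominator \<open>pderiv p ^ Suc (degree p)\<close>; this fraction
  need not be reduced.\<close>

definition traub_num :: "complex poly \<Rightarrow> complex \<Rightarrow> complex poly" where
  "traub_num p \<delta> = newton_num p * pderiv p ^ degree p
     - smult \<delta> (homog_eval p (newton_num p) (pderiv p))"

lemma traub_eq:
  assumes "pderiv p \<noteq> 0"
  shows "traub p \<delta> = to_fract (traub_num p \<delta>) / to_fract (pderiv p ^ Suc (degree p))"
proof -
  have "smult c x = [:c:] * x" for c and x :: "complex poly"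
    by simp
  then show ?thesis
    using assms
    by (simp add: traub_def newton_eq poly_comp_fract_divide traub_num_def to_fract_diff const_fract_def
       to_fract_power divide_simps del: mult_pCons_left)
qed

lemma pderiv_nonzero:
  fixes p :: "complex poly"
  assumes "degree p \<ge> 2"
  shows "pderiv p \<noteq> 0"
  using assms by (auto simp: pderiv_eq_0_iff)

text \<open>At a critical point \<open>newton_num p\<close> equals \<open>- poly p z\<close>, and
  every term of the homogenised polynomial except the leading one carries a factor
  \<open>pderiv p\<close>. So for nonzero \<delta> the numerator is nonzero where the denominator
  vanishes.\<close>

lemma traub_map_pole:
  assumes "degree p \<ge> 2" "poly (pderiv p) z = 0" "poly p z \<noteq> 0"
  shows "traub_map p \<delta> (Some z) = None"
proof (cases "\<delta> = 0")
  \<comment> \<open>At \<delta> = 0 the numerator \<open>traub_num\<close> also vanishes at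
    \<open>z\<close>, so the fraction of the Newton map is used instead.\<close>
  case True
  then have "traub p \<delta> = newton p"
    by (simp add: traub_def const_fract_def)
  then have "traub p \<delta> = to_fract (newton_num p) / to_fract (pderiv p)"
    using assms by (simp add: newton_eq pderiv_nonzero)
  moreover have "poly (newton_num p) z \<noteq> 0"
    using assms by (simp add: newton_num_def)
  ultimately show ?thesis
    using assms by (simp add: rational_map_pole pderiv_nonzero)
next
  case False
  have "degree p > 0" "lead_coeff p \<noteq> 0" using assms by auto
  have "poly (homog_eval p (newton_num p) (pderiv p)) z =
      (\<Sum>i\<le>degree p. if i = degree p then lead_coeff p * (- poly p z) ^ degree p else 0)"
    unfolding homog_eval_def poly_sum
    by (rule sum.cong) (use assms in \<open>auto simp: newton_num_def\<close>)
  also have "\<dots> = lead_coeff p * (- poly p z) ^ degree p"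
    by simp
  also have "\<dots> \<noteq> 0" using assms by auto
  finally have "poly (traub_num p \<delta>) z \<noteq> 0"
    using False assms \<open>degree p > 0\<close> by (simp add: traub_num_def power_0_left)
  then show ?thesis
    using assms by (simp only: traub_eq pderiv_nonzero[OF assms(1)] not_False_eq_True)
      (intro rational_map_pole, auto simp: pderiv_nonzero)
qed

text \<open>With degree \<open>d\<close> and leading coefficient \<open>c\<close>, the numerator has
  coefficient \<open>c ^ Suc d * ((d - 1) * d ^ d - \<delta> * (d - 1) ^ d)\<close> at exponent
  \<open>d * d\<close>, while the denominator has degree \<open>(d + 1) * (d - 1)\<close>, which is
  one less.\<close>

lemma traub_map_infinity:
  fixes \<delta> :: real
  assumes d: "degree p \<ge> 2" and \<delta>: "\<delta> \<in> {0..1}"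
  shows "traub_map p (of_real \<delta>) None = None"
proof -
  define d where "d = degree p"
  define c where "c = lead_coeff p"
  define q where "q = newton_num p"
  define r where "r = pderiv p"
  have c: "c \<noteq> 0" using assms unfolding c_def by auto
  have d2: "d \<ge> 2" using assms d_def by simp
  obtain m where m: "d = Suc m" using d2 by (cases d) auto
  have r: "degree r = d - 1" "lead_coeff r = of_nat d * c" "r \<noteq> 0"
    using m pderiv_nonzero[OF d] by (auto simp: r_def d_def c_def degree_pderiv coeff_pderiv)
  have coeff_q: "coeff q n = (of_nat n - 1) * coeff p n" for n
    by (cases n) (auto simp: q_def newton_num_def coeff_pderiv algebra_simps)
  have nz: "(of_nat d - 1 :: complex) \<noteq> 0"
    using d2 by auto
  have q: "degree q = d"
    by (rule antisym, rule degree_le)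
      (use nz c in \<open>auto simp: coeff_q d_def c_def coeff_eq_0 intro!: le_degree\<close>)
  have lq: "coeff q d = (of_nat d - 1) * c"
    by (simp add: coeff_q c_def d_def)
  have q0: "q \<noteq> 0" using q d2 by auto
  have dd: "d + (d - 1) * d = d * d"
    using d2 by (cases d) auto
  have 1: "coeff (q * r ^ d) (d * d) = (of_nat d - 1) * c * (of_nat d * c) ^ d"
  proof -
    have "degree (q * r ^ d) = d * d"
      using q q0 r d2 dd by (simp add: degree_mult_eq degree_power_eq mult.commute)
    then have "coeff (q * r ^ d) (d * d) = lead_coeff (q * r ^ d)" by simp
    also have "\<dots> = lead_coeff q * lead_coeff r ^ d"
      by (simp only: lead_coeff_mult lead_coeff_power)
    finally show ?thesis using q lq r by simp
  qed
  have 2: "coeff (homog_eval p q r) (d * d) = c * ((of_nat d - 1) * c) ^ d"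
  proof -
    \<comment> \<open>Since \<open>r\<close> has degree only \<open>d - 1\<close>, every term with
      \<open>i < d\<close> stays below degree \<open>d * d\<close>.\<close>
    have "coeff (smult (coeff p i) (q ^ i * r ^ (d - i))) (d * d) =
        (if i = d then c * ((of_nat d - 1) * c) ^ d else 0)" if "i \<le> d" for i
    proof (cases "i = d")
      case True
      have "coeff (q ^ d) (d * d) = lead_coeff (q ^ d)"
        using q q0 by (simp add: degree_power_eq)
      also have "\<dots> = lead_coeff q ^ d" by (rule lead_coeff_power)
      finally show ?thesis using True q lq by (simp add: c_def d_def)
    next
      case False
      have "degree (q ^ i * r ^ (d - i)) = i * d + (d - i) * (d - 1)"
        using q q0 r by (simp add: degree_mult_eq degree_power_eq mult.commute)
      also have "\<dots> < i * d + (d - i) * d"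
        using False that d2 by simp
      also have "\<dots> = d * d" using that by (simp flip: add_mult_distrib)
      finally show ?thesis using False by (simp add: coeff_eq_0)
    qed
    then show ?thesis
      by (simp add: homog_eval_def coeff_sum flip: d_def)
  qed
  have "coeff (traub_num p (of_real \<delta>)) (d * d) = 
      (of_nat d - 1) * c * (of_nat d * c) ^ d - of_real \<delta> * (c * ((of_nat d - 1) * c) ^ d)"
    using 1 2 unfolding traub_num_def q_def[symmetric] r_def[symmetric] d_def[symmetric]
    by simp
  also have "\<dots> = c ^ Suc d * of_real ((real d - 1) * real d ^ d - \<delta> * (real d - 1) ^ d)"
    by (simp add: power_mult_distrib) (simp add: algebra_simps)
  also have "\<dots> \<noteq> 0"
  proof -
    \<comment> \<open>Here \<delta> \<le> 1 enters; it makes the real factor strictly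
      positive.\<close>
    have "\<delta> * (real d - 1) ^ d \<le> (real d - 1) ^ d"
      using \<delta> d2 by (intro mult_left_le_one_le) auto
    also have "\<dots> < real d ^ d"
      using d2 by (intro power_strict_mono) auto
    also have "\<dots> \<le> (real d - 1) * real d ^ d"
      using d2 by simp
    finally show ?thesis using c by (simp del: of_real_diff of_real_mult)
  qed
  finally have "d * d \<le> degree (traub_num p (of_real \<delta>))"
    by (rule le_degree)
  moreover have "degree (r ^ Suc d) < d * d"
  proof -
    have "degree (r ^ Suc d) = Suc d * (d - 1)"
      using r by (simp only: degree_power_eq not_False_eq_True)
    also have "\<dots> < d * d"
      using d2 by (cases d) auto
    finally show ?thesis .
  qed
  ultimately have "degree (r ^ Suc d) < degree (traub_num p (of_real \<delta>))"
    by simp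
  then show ?thesis
    using r unfolding r_def d_def
    by (simp only: traub_eq not_False_eq_True) (intro rational_map_infinity, auto)
qed

text \<open>The Newton map has multiplier \<open>1 - 1 / n\<close> at a root of multiplicity
  \<open>n\<close>, and \<open>p / p'\<close> is linear in \<open>z - \<alpha>\<close>, so the whole
  Traub map is linear about \<alpha>. Working with fractions, where common factors cancel, also
  covers \<open>w = 0\<close>, where the derivative may vanish.\<close>

lemma traub_map_power:
  fixes c \<alpha> \<delta> :: complex and n :: nat
  assumes c: "c \<noteq> 0" and n: "n \<ge> 1"
  defines "k \<equiv> (1 - 1 / of_nat n) - \<delta> * ((1 - 1 / of_nat n) ^ n / of_nat n)"
  shows "traub_map (smult c ([:- \<alpha>, 1:] ^ n)) \<delta> (Some (\<alpha> + w)) = Some (\<alpha> + k * w)"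
proof -
  define X where "X = [:- \<alpha>, 1:]"
  define p where "p = smult c (X ^ n)"
  define l where "l = (1 - 1 / of_nat n :: complex)"
  have X0: "X \<noteq> 0" by (simp add: X_def)
  have n0: "(of_nat n :: complex) \<noteq> 0" using n by simp
  have pd: "pderiv p = smult (c * of_nat n) (X ^ (n - 1))"
    using n by (cases n) (auto simp: p_def X_def pderiv_smult pderiv_power_Suc pderiv_pCons 
        simp del: power_Suc)
  have Xn: "X ^ n = X * X ^ (n - 1)"
    using n by (cases n) auto
  have quot: "to_fract (smult a (X ^ n)) / to_fract (pderiv p) = to_fract (smult (a / (c * of_nat n)) X)" for a
  proof -
    have "smult a (X ^ n) = smult (a / (c * of_nat n)) X * pderiv p"
      unfolding pd Xn using c n0 by simp
    moreover have "pderiv p \<noteq> 0"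
      unfolding pd using c n0 X0 by simp
    ultimately show ?thesis by (simp only: to_fract_mult) simp
  qed
  have "newton p = to_fract [:0, 1:] - to_fract (smult (1 / of_nat n) X)"
    unfolding newton_def using quot[of c] c by (simp add: p_def)
  also have "\<dots> = to_fract ([:0, 1:] - smult (1 / of_nat n) X)"
    by simp
  also have "[:0, 1:] - smult (1 / of_nat n) X = [:\<alpha>:] + smult l X"
    by (simp add: X_def l_def algebra_simps)
  finally have N: "newton p = to_fract ([:\<alpha>:] + smult l X)" .
  have "pcompose X ([:\<alpha>:] + smult l X) = smult l X"
    by (simp add: X_def pcompose_pCons)
  moreover have "pcompose (X ^ m) Y = pcompose X Y ^ m" for m Y
    by (induction m) (auto simp: pcompose_mult pcompose_1)
  ultimately have "pcompose p ([:\<alpha>:] + smult l X) = smult (c * l ^ n) (X ^ n)"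
    by (simp add: p_def pcompose_smult smult_power)
  then have "poly_comp_fract p (newton p) / to_fract (pderiv p) = to_fract (smult (l ^ n / of_nat n) X)"
    using c by (simp only: N poly_comp_fract_to_fract quot) simp
  then have "traub p \<delta> = to_fract ([:\<alpha>:] + smult l X - [:\<delta>:] * smult (l ^ n / of_nat n) X)"
    unfolding traub_def N const_fract_def by (simp only: to_fract_diff to_fract_mult)
  then have "traub_map p \<delta> (Some (\<alpha> + w)) =
      Some (poly ([:\<alpha>:] + smult l X - [:\<delta>:] * smult (l ^ n / of_nat n) X) (\<alpha> + w))"
    by (simp only: rational_map_to_fract)
  then show ?thesis
    unfolding p_def[symmetric] X_def[symmetric]
    by (simp add: X_def k_def l_def) (simp add: algebra_simps add_divide_distrib diff_divide_distrib)
qed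

section \<open>Transferring basins between the plane and the sphere\<close>

text \<open>Loops are pulled back along \<open>g\<close>, deformed in \<open>S\<close> and pushed
  forward; \<open>f \<circ> g\<close> is the identity on \<open>T\<close>.\<close>

lemma simply_connected_homeomorphic_image:
  assumes "homeomorphism S T f g" "simply_connected S"
  shows "simply_connected T"
  unfolding simply_connected_def
proof (intro allI impI)
  fix p q :: "real \<Rightarrow> 'b"
  assume *: "path p \<and> pathfinish p = pathstart p \<and> path_image p \<subseteq> T \<and>
    path q \<and> pathfinish q = pathstart q \<and> path_image q \<subseteq> T"
  have f: "continuous_on S f" "f ` S = T" "continuous_on T g" "g ` T = S" "\<And>y. y \<in> T \<Longrightarrow> f (g y) = y"
    using assms(1) by (auto simp: homeomorphism_def)
  have loop: "path (g \<circ> r) \<and> pathfinish (g \<circ> r) = pathstart (g \<circ> r) \<and> path_image (g \<circ> r) \<subseteq> S"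
    if "path r" "pathfinish r = pathstart r" "path_image r \<subseteq> T" for r
    using that f by (auto simp: path_continuous_image continuous_on_subset pathfinish_compose
        pathstart_compose path_image_compose)
  have "homotopic_loops S (g \<circ> p) (g \<circ> q)"
    using assms(2) loop[of p] loop[of q] * unfolding simply_connected_def by blast
  then have "homotopic_loops T (f \<circ> (g \<circ> p)) (f \<circ> (g \<circ> q))"
    using f by (intro homotopic_loops_continuous_image[of S]) auto
  moreover have "homotopic_loops T r (f \<circ> (g \<circ> r))"
    if "path r" "pathfinish r = pathstart r" "path_image r \<subseteq> T" for r
  proof (rule homotopic_loops_eq)
    show "r u = (f \<circ> (g \<circ> r)) u" if "u \<in> {0..1}" for u
    proof -
      have "r u \<in> T" using that \<open>path_image r \<subseteq> T\<close> by (auto simp: path_image_def)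
      then show ?thesis using f by simp
    qed
  qed (use that in auto)
  ultimately show "homotopic_loops T p q"
    using * by (meson homotopic_loops_sym homotopic_loops_trans)
qed

text \<open>Each inclusion is the maximality of one component, applied to the connected image of the
  other.\<close>

lemma homeomorphism_connected_component_set:
  assumes h: "homeomorphism S T f g" and x: "x \<in> S"
  shows "connected_component_set T (f x) = f ` connected_component_set S x"
proof (rule antisym)
  have f: "continuous_on S f" "f ` S = T" "continuous_on T g" "g ` T = S" 
      "\<And>y. y \<in> T \<Longrightarrow> f (g y) = y" "\<And>x. x \<in> S \<Longrightarrow> g (f x) = x"
    using h by (auto simp: homeomorphism_def)
  have cs: "connected_component_set S x \<subseteq> S" "connected_component_set T (f x) \<subseteq> T"
    by (auto simp: connected_component_subset)
  show "f ` connected_component_set S x \<subseteq> connected_component_set T (f x)"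
    using x f cs
    by (intro connected_component_maximal connected_continuous_image)
      (auto intro: continuous_on_subset simp: connected_component_refl)
  have "g ` connected_component_set T (f x) \<subseteq> connected_component_set S x"
  proof (intro connected_component_maximal connected_continuous_image)
    have "f x \<in> connected_component_set T (f x)" using x f by (auto simp: connected_component_refl)
    then show "x \<in> g ` connected_component_set T (f x)" using x f by (metis imageI)
  qed (use x f cs in \<open>auto intro: continuous_on_subset\<close>)
  then have "f ` g ` connected_component_set T (f x) \<subseteq> f ` connected_component_set S x"
    by blast
  moreover have "f ` g ` connected_component_set T (f x) = connected_component_set T (f x)"
    using cs f by (force simp: image_iff)
  ultimately show "connected_component_set T (f x) \<subseteq> f ` connected_component_set S x"
    by simp
qed

lemma continuous_on_Some_sphere: "continuous_on S (Some :: complex \<Rightarrow> riemann_sphere)"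
  by (rule continuous_on_subset[of UNIV])
    (auto simp: continuous_on_open_vimage open_riemann_sphere_iff)

lemma open_image_Some: "open V \<Longrightarrow> open (Some ` V :: riemann_sphere set)"
  by (auto simp: open_riemann_sphere_iff inj_vimage_image_eq)

lemma continuous_on_the_sphere: "continuous_on (range Some) (the :: riemann_sphere \<Rightarrow> complex)"
proof (subst continuous_on_open_vimage)
  show "open (range Some :: riemann_sphere set)"
    by (simp add: open_image_Some)
  have "the -` V \<inter> range Some = (Some ` V :: riemann_sphere set)" for V
    by force
  then show "\<forall>V. open V \<longrightarrow> open (the -` V \<inter> range Some :: riemann_sphere set)"
    by (simp add: open_image_Some)
qed

lemma tendsto_Some_sphere_iff:
  "((\<lambda>x. Some (f x) :: riemann_sphere) \<longlongrightarrow> Some l) F \<longleftrightarrow> (f \<longlongrightarrow> l) F"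
proof
  assume "(f \<longlongrightarrow> l) F"
  then show "((\<lambda>x. Some (f x) :: riemann_sphere) \<longlongrightarrow> Some l) F"
    by (rule continuous_on_tendsto_compose[OF continuous_on_Some_sphere[of UNIV]]) auto
next
  assume lim: "((\<lambda>x. Some (f x) :: riemann_sphere) \<longlongrightarrow> Some l) F"
  show "(f \<longlongrightarrow> l) F"
  proof (rule topological_tendstoI)
    fix V assume "open V" "l \<in> V"
    then have "eventually (\<lambda>x. (Some (f x) :: riemann_sphere) \<in> Some ` V) F"
      by (intro topological_tendstoD[OF lim]) (auto simp: open_image_Some)
    then show "eventually (\<lambda>x. f x \<in> V) F"
      by eventually_elim auto
  qed
qed

text \<open>\<open>range Some\<close> is an open neighbourhood of every finite point that misses
  infinity. Hence an orbit absorbed at infinity lies in no basin of a finite point.\<close>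

lemma not_tendsto_None_Some:
  assumes "F \<noteq> bot"
  shows "\<not> ((\<lambda>x. None :: riemann_sphere) \<longlongrightarrow> Some l) F"
proof
  assume "((\<lambda>x. None :: riemann_sphere) \<longlongrightarrow> Some l) F"
  then have "eventually (\<lambda>x. (None :: riemann_sphere) \<in> range Some) F"
    by (rule topological_tendstoD) (auto simp: open_image_Some)
  with assms show False by (auto simp: eventually_False)
qed

text \<open>
  The planar map \<^term>\<open>t\<close> may take junk values at the poles of \<^term>\<open>R\<close>, as long as these points
  become fixed points distinct from \<^term>\<open>w\<^sub>0\<close>.
\<close>

lemma basin_sphere:
  fixes R :: "riemann_sphere \<Rightarrow> riemann_sphere" and \<phi> :: "complex \<Rightarrow> complex"
  assumes homeo: "homeomorphism UNIV UNIV \<phi> \<psi>"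
    and inf: "R None = None"
    and step: "\<And>w. R (Some (\<phi> w)) = Some (\<phi> (t w)) \<or> R (Some (\<phi> w)) = None \<and> t w = w \<and> w \<noteq> w\<^sub>0"
  shows "basin R (Some (\<phi> w\<^sub>0)) = (Some \<circ> \<phi>) ` basin t w\<^sub>0"
proof -
  have \<phi>: "\<And>w. \<psi> (\<phi> w) = w" "\<And>z. \<phi> (\<psi> z) = z" "continuous_on UNIV \<phi>" "continuous_on UNIV \<psi>"
    using homeo by (auto simp: homeomorphism_def)
  have R_None: "(R ^^ m) None = None" for m
    by (induction m) (auto simp: inf)
  have lim\<phi>: "((\<lambda>m. \<phi> (g m)) \<longlonglongrightarrow> \<phi> w\<^sub>0) \<longleftrightarrow> (g \<longlonglongrightarrow> w\<^sub>0)" for g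
  proof
    assume "(\<lambda>m. \<phi> (g m)) \<longlonglongrightarrow> \<phi> w\<^sub>0"
    then have "(\<lambda>m. \<psi> (\<phi> (g m))) \<longlonglongrightarrow> \<psi> (\<phi> w\<^sub>0)"
      by (rule continuous_on_tendsto_compose[OF \<phi>(4)]) auto
    then show "g \<longlonglongrightarrow> w\<^sub>0" by (simp add: \<phi>)
  qed (rule continuous_on_tendsto_compose[OF \<phi>(3)], auto)
  have "Some (\<phi> w) \<in> basin R (Some (\<phi> w\<^sub>0)) \<longleftrightarrow> w \<in> basin t w\<^sub>0" for w
  proof (cases "\<exists>m. R (Some (\<phi> ((t ^^ m) w))) = None \<and> t ((t ^^ m) w) = (t ^^ m) w \<and> (t ^^ m) w \<noteq> w\<^sub>0")
    case False
    then have "(R ^^ m) (Some (\<phi> w)) = Some (\<phi> ((t ^^ m) w))" for m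
    proof (induction m)
      case (Suc m)
      with False step[of "(t ^^ m) w"] show ?case by auto
    qed simp
    then show ?thesis
      by (simp add: basin_def tendsto_Some_sphere_iff lim\<phi>)
  next
    case True
    \<comment> \<open>\<open>M\<close> is the first time the orbit hits a pole. Until then both
      orbits correspond; afterwards the spherical one stays at infinity and the planar one is stuck
      at a fixed point other than \<open>w\<^sub>0\<close>, so neither converges to the
      target.\<close>
    define M where "M = (LEAST m. R (Some (\<phi> ((t ^^ m) w))) = None)"
    have *: "R (Some (\<phi> ((t ^^ M) w))) = None" 
      unfolding M_def using True by (auto intro: LeastI)
    then have **: "t ((t ^^ M) w) = (t ^^ M) w" "(t ^^ M) w \<noteq> w\<^sub>0"
      using step[of "(t ^^ M) w"] by auto
    have "(R ^^ m) (Some (\<phi> w)) = Some (\<phi> ((t ^^ m) w))" if "m \<le> M" for m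
      using that
    proof (induction m)
      case (Suc m)
      then have "R (Some (\<phi> ((t ^^ m) w))) \<noteq> None"
        using not_less_Least[of m "\<lambda>m. R (Some (\<phi> ((t ^^ m) w))) = None"]
        unfolding M_def by auto
      with Suc step[of "(t ^^ m) w"] show ?case by auto
    qed simp
    with * have "(R ^^ Suc M) (Some (\<phi> w)) = None" by simp
    then have "(R ^^ (k + Suc M)) (Some (\<phi> w)) = None" for k
      by (simp only: funpow_add o_apply R_None)
    then have "Some (\<phi> w) \<notin> basin R (Some (\<phi> w\<^sub>0))"
      unfolding basin_def
      using LIMSEQ_ignore_initial_segment[of "\<lambda>m. (R ^^ m) (Some (\<phi> w))" _ "Suc M"]
        not_tendsto_None_Some[of sequentially "\<phi> w\<^sub>0"] by auto
    moreover have "(t ^^ (k + M)) w = (t ^^ M) w" for k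
      by (induction k) (use ** in auto)
    then have "w \<notin> basin t w\<^sub>0"
      unfolding basin_def 
      using LIMSEQ_ignore_initial_segment[of "\<lambda>m. (t ^^ m) w" w\<^sub>0 M] **
      by (auto simp: LIMSEQ_const_iff)
    ultimately show ?thesis by simp
  qed
  moreover have "None \<notin> basin R (Some (\<phi> w\<^sub>0))"
    by (simp add: basin_def R_None not_tendsto_None_Some)
  moreover have "\<exists>w. z = Some (\<phi> w)" if "z \<noteq> None" for z
    using that \<phi>(2) by (metis not_None_eq)
  ultimately have "z \<in> basin R (Some (\<phi> w\<^sub>0)) \<longleftrightarrow> z \<in> (Some \<circ> \<phi>) ` basin t w\<^sub>0" for z
    by (cases "z = None") force+
  then show ?thesis by blast
qed

text \<open>The map \<open>Some \<circ> \<phi>\<close> is a homeomorphism from any planar set onto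
  its image, so the correspondence of basins passes to components and to simple
  connectivity.\<close>

lemma immediate_basin_sphere:
  fixes R :: "riemann_sphere \<Rightarrow> riemann_sphere" and \<phi> :: "complex \<Rightarrow> complex"
  assumes homeo: "homeomorphism UNIV UNIV \<phi> \<psi>"
    and inf: "R None = None"
    and step: "\<And>w. R (Some (\<phi> w)) = Some (\<phi> (t w)) \<or> R (Some (\<phi> w)) = None \<and> t w = w \<and> w \<noteq> w\<^sub>0"
    and w0: "w\<^sub>0 \<in> basin t w\<^sub>0"
  shows "immediate_basin R (Some (\<phi> w\<^sub>0)) = (Some \<circ> \<phi>) ` immediate_basin t w\<^sub>0"
    and "simply_connected (immediate_basin t w\<^sub>0) \<Longrightarrow>
      simply_connected (immediate_basin R (Some (\<phi> w\<^sub>0)))"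
proof -
  have \<phi>: "\<And>w. \<psi> (\<phi> w) = w" "\<And>z. \<phi> (\<psi> z) = z" "continuous_on UNIV \<phi>" "continuous_on UNIV \<psi>"
    using homeo by (auto simp: homeomorphism_def)
  have h: "homeomorphism S ((Some \<circ> \<phi>) ` S) (Some \<circ> \<phi>) (\<psi> \<circ> the)" for S
  proof (rule homeomorphismI)
    show "continuous_on S (Some \<circ> \<phi>)"
      by (intro continuous_on_compose continuous_on_Some_sphere continuous_on_subset[OF \<phi>(3)]) auto
    show "continuous_on ((Some \<circ> \<phi>) ` S) (\<psi> \<circ> the)"
      by (intro continuous_on_compose continuous_on_subset[OF \<phi>(4)]
          continuous_on_subset[OF continuous_on_the_sphere]) auto
  qed (auto simp: \<phi>)
  show *: "immediate_basin R (Some (\<phi> w\<^sub>0)) = (Some \<circ> \<phi>) ` immediate_basin t w\<^sub>0"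
    using homeomorphism_connected_component_set[OF h w0]
    unfolding immediate_basin_def basin_sphere[OF homeo inf step] by simp
  show "simply_connected (immediate_basin R (Some (\<phi> w\<^sub>0)))" 
    if "simply_connected (immediate_basin t w\<^sub>0)"
    using simply_connected_homeomorphic_image[OF h that] by (simp add: *)
qed

section \<open>Maximum principle and simple connectivity of planar immediate basins\<close>

lemma frontier_holomorphic_image_subset:
  assumes K: "compact K" and cont: "continuous_on K f" and holo: "f holomorphic_on interior K"
  shows "frontier (f ` K) \<subseteq> f ` frontier K"
proof
  fix w assume w: "w \<in> frontier (f ` K)"
  have clK: "closure K = K" using K by (simp add: compact_imp_closed)
  have "compact (f ` K)" by (rule compact_continuous_image[OF cont K])
  then have wK: "w \<in> f ` K"
    using w frontier_subset_closed compact_imp_closed by blast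
  have fr: "frontier K \<subseteq> K" "compact (frontier K)"
    using K by (auto simp: frontier_subset_compact compact_frontier)
  show "w \<in> f ` frontier K"
  proof (rule ccontr)
    assume "w \<notin> f ` frontier K"
    moreover have "closed (f ` frontier K)"
      by (intro compact_imp_closed compact_continuous_image fr continuous_on_subset[OF cont])
    ultimately have "open (- (f ` frontier K))" "w \<in> - (f ` frontier K)" by auto
    then obtain e where e: "e > 0" "ball w e \<subseteq> - (f ` frontier K)"
      using openE by blast
    have "w \<in> closure (- (f ` K))"
      using w by (simp add: frontier_def interior_closure)
    then obtain v where v: "v \<notin> f ` K" "dist v w < e / 3"
      using e(1) by (metis closure_approachable ComplD divide_pos_pos zero_less_numeral)
    obtain z where z: "z \<in> K" "f z = w" using wK by blast
    have "norm (1 / (f z - v)) \<le> 1 / (2 * e / 3)"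
    proof (rule maximum_modulus_frontier[where S = K and f = "\<lambda>z. 1 / (f z - v)"])
      show "(\<lambda>z. 1 / (f z - v)) holomorphic_on interior K"
        using v(1) interior_subset by (intro holomorphic_intros holo) force
      show "continuous_on (closure K) (\<lambda>z. 1 / (f z - v))"
        unfolding clK using v(1) by (intro continuous_intros cont) force
      show "bounded K" using K by (rule compact_imp_bounded)
      show "norm (1 / (f x - v)) \<le> 1 / (2 * e / 3)" if "x \<in> frontier K" for x
      proof -
        have "f x \<notin> ball w e" using e(2) that by blast
        then have "dist w (f x) \<ge> e" by simp
        moreover have "dist w (f x) \<le> dist (f x) v + dist v w"
          by (metis dist_commute dist_triangle)
        ultimately have "dist (f x) v \<ge> 2 * e / 3" using v(2) by linarith
        then have "1 / dist (f x) v \<le> 1 / (2 * e / 3)"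
          using e(1) by (intro frac_le) auto
        then show ?thesis by (simp add: norm_divide dist_norm)
      qed
      show "z \<in> K" by fact
    qed
    moreover have v': "norm (f z - v) < e / 3" "norm (f z - v) > 0"
      using v z by (auto simp: dist_norm norm_minus_commute)
    ultimately have "2 * e / 3 \<le> norm (f z - v)"
      using e(1) by (simp add: norm_divide divide_le_eq mult.commute)
    with v' e(1) show False by linarith
  qed
qed

lemma funpow_in_basin_iff: "(t ^^ m) z \<in> basin t w \<longleftrightarrow> z \<in> basin t w"
proof -
  have "(t ^^ i) ((t ^^ m) z) = (t ^^ (i + m)) z" for i
    by (simp add: funpow_add)
  then have "(t ^^ m) z \<in> basin t w \<longleftrightarrow> (\<lambda>i. (t ^^ (i + m)) z) \<longlonglongrightarrow> w"
    by (simp add: basin_def)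
  also have "\<dots> \<longleftrightarrow> z \<in> basin t w"
    unfolding basin_def
    using LIMSEQ_ignore_initial_segment[of "\<lambda>i. (t ^^ i) z" w m] LIMSEQ_offset[of "\<lambda>i. (t ^^ i) z" m w]
    by blast
  finally show ?thesis .
qed

text \<open>
  A loop in the basin is eventually mapped close to the attracting point. If no iterate of the
  filled loop \<open>K\<close> meets the pole \<open>a\<close>, the maximum principle carries this over to \<open>K\<close>. The first
  iterate that does meet \<open>a\<close> is compact with frontier in the basin, so it would have to contain
  the whole unbounded barrier \<open>L\<close>.
\<close>

lemma immediate_basin_simply_connected:
  fixes t :: "complex \<Rightarrow> complex"
  assumes holo: "t holomorphic_on - {a}"
    and fp: "t w\<^sub>0 = w\<^sub>0"
    and der: "(t has_field_derivative D) (at w\<^sub>0)" "norm D < 1"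
    and L: "connected L" "\<not> bounded L" "a \<in> L" "L \<inter> basin t w\<^sub>0 = {}"
  shows "simply_connected (immediate_basin t w\<^sub>0)"
proof -
  define B where "B = basin t w\<^sub>0"
  define U where "U = immediate_basin t w\<^sub>0"
  have aB: "a \<notin> B" using L by (auto simp: B_def)
  have iterB: "(t ^^ m) z \<in> B \<longleftrightarrow> z \<in> B" for m z
    unfolding B_def by (rule funpow_in_basin_iff)
  have w0B: "w\<^sub>0 \<in> B"
  proof -
    have "(t ^^ m) w\<^sub>0 = w\<^sub>0" for m by (induction m) (auto simp: fp)
    then show ?thesis by (simp add: B_def basin_def)
  qed
  \<comment> \<open>Any \<open>k\<close> strictly between \<open>norm D\<close> and 1 is a
    contraction factor on a small enough ball.\<close>
  obtain k where k: "norm D < k" "k < 1" using der(2) dense by blast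
  have k0: "0 \<le> k" using k(1) norm_ge_zero[of D] by linarith
  obtain r where r: "r > 0" "\<And>z. z \<in> cball w\<^sub>0 r \<Longrightarrow> dist (t z) w\<^sub>0 \<le> k * dist z w\<^sub>0"
  proof -
    have "((\<lambda>z. norm ((t z - t w\<^sub>0) / (z - w\<^sub>0))) \<longlongrightarrow> norm D) (at w\<^sub>0)"
      using der(1) by (intro tendsto_norm) (simp add: has_field_derivative_iff)
    then have "eventually (\<lambda>z. norm ((t z - t w\<^sub>0) / (z - w\<^sub>0)) < k) (at w\<^sub>0)"
      using k(1) by (rule order_tendstoD)
    then obtain e where e: "e > 0" 
      "\<And>z. z \<noteq> w\<^sub>0 \<Longrightarrow> dist z w\<^sub>0 < e \<Longrightarrow> norm ((t z - t w\<^sub>0) / (z - w\<^sub>0)) < k"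
      by (auto simp: eventually_at)
    have "dist (t z) w\<^sub>0 \<le> k * dist z w\<^sub>0" if "dist z w\<^sub>0 < e" for z
    proof (cases "z = w\<^sub>0")
      case False
      with e(2)[OF False that] show ?thesis
        by (simp add: fp dist_norm norm_divide field_simps)
    qed (simp add: fp)
    then show thesis using e(1) by (intro that[of "e / 2"]) (auto simp: dist_commute)
  qed
  have t_ball: "dist (t z) w\<^sub>0 \<le> dist z w\<^sub>0" if "z \<in> cball w\<^sub>0 r" for z
    using r(2)[OF that] k(2) mult_left_le_one_le[of "dist z w\<^sub>0" k] k0 by simp
  have cballB: "cball w\<^sub>0 r \<subseteq> B"
  proof
    fix z assume z: "z \<in> cball w\<^sub>0 r"
    have *: "(t ^^ m) z \<in> cball w\<^sub>0 r \<and> dist ((t ^^ m) z) w\<^sub>0 \<le> k ^ m * r" for m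
    proof (induction m)
      case (Suc m)
      then have "dist ((t ^^ Suc m) z) w\<^sub>0 \<le> k * dist ((t ^^ m) z) w\<^sub>0"
        using r(2) by simp
      also have "\<dots> \<le> k * (k ^ m * r)" using Suc k0 by (intro mult_left_mono) auto
      finally show ?case
        using Suc t_ball[of "(t ^^ m) z"] by (auto simp: dist_commute)
    qed (use z in \<open>auto simp: dist_commute\<close>)
    have "(\<lambda>m. k ^ m * r) \<longlonglongrightarrow> 0"
      using tendsto_mult_left_zero[OF LIMSEQ_realpow_zero[OF k0 k(2)], of r] .
    then have "(\<lambda>m. dist ((t ^^ m) z) w\<^sub>0) \<longlonglongrightarrow> 0"
      by (rule Lim_null_comparison[rotated]) (use * in auto)
    then show "z \<in> B"
      by (simp add: B_def basin_def tendsto_dist_iff[symmetric])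
  qed
  \<comment> \<open>The orbit avoids the pole at times 0 to \<open>m - 1\<close>, which is what
    makes \<open>t ^^ m\<close> holomorphic on \<open>E m\<close>; time \<open>m\<close> itself is
    unrestricted.\<close>
  define E where "E m = {z. \<forall>i<m. (t ^^ i) z \<noteq> a}" for m
  have B_E: "B \<subseteq> E m" for m
    using aB iterB by (auto simp: E_def)
  have E: "open (E m) \<and> (t ^^ m) holomorphic_on E m" for m
  proof (induction m)
    case (Suc m)
    have eq: "E (Suc m) = E m \<inter> (t ^^ m) -` (- {a})"
      by (auto simp: E_def less_Suc_eq)
    have "open (E (Suc m))"
      unfolding eq using Suc by (intro continuous_open_preimage) (auto intro: holomorphic_on_imp_continuous_on)
    moreover have "(t \<circ> (t ^^ m)) holomorphic_on E (Suc m)"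
      by (rule holomorphic_on_compose_gen[where t = "- {a}"])
        (use Suc holo in \<open>auto simp: eq intro: holomorphic_on_subset\<close>)
    ultimately show ?case by (simp add: o_def)
  qed (simp add: E_def)
  have contE: "continuous_on (E m) (t ^^ m)" for m
    using E by (intro holomorphic_on_imp_continuous_on) auto
  \<comment> \<open>The sets \<open>C m\<close> form an increasing open exhaustion of
    \<open>B\<close>: once an orbit enters the ball it stays there.\<close>
  define C where "C m = E m \<inter> (t ^^ m) -` ball w\<^sub>0 r" for m
  have openC: "open (C m)" for m
    unfolding C_def using E contE by (intro continuous_open_preimage) auto
  have C_B: "C m \<subseteq> B" for m
  proof
    fix z assume "z \<in> C m"
    then have "(t ^^ m) z \<in> B" using cballB by (auto simp: C_def)
    then show "z \<in> B" by (simp add: iterB)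
  qed
  have B_C: "B \<subseteq> (\<Union>m. C m)"
  proof
    fix z assume z: "z \<in> B"
    then have "eventually (\<lambda>m. dist ((t ^^ m) z) w\<^sub>0 < r) sequentially"
      using r(1) by (intro tendstoD) (auto simp: B_def basin_def)
    then obtain m where "dist ((t ^^ m) z) w\<^sub>0 < r"
      by (auto simp: eventually_sequentially)
    then have "z \<in> C m" using z B_E by (auto simp: C_def dist_commute)
    then show "z \<in> (\<Union>m. C m)" by blast
  qed
  have C_mono: "C m \<subseteq> C m'" if "m \<le> m'" for m m'
  proof (rule lift_Suc_mono_le[OF _ that])
    fix m
    show "C m \<subseteq> C (Suc m)"
    proof
      fix z assume z: "z \<in> C m"
      then have "dist ((t ^^ Suc m) z) w\<^sub>0 \<le> dist ((t ^^ m) z) w\<^sub>0"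
        using t_ball by (auto simp: C_def)
      with z have "dist ((t ^^ Suc m) z) w\<^sub>0 < r" by (simp add: C_def dist_commute)
      moreover have "z \<in> E (Suc m)" using z C_B B_E by blast
      ultimately show "z \<in> C (Suc m)" by (auto simp: C_def dist_commute)
    qed
  qed
  have "open B"
    using B_C C_B openC by (metis (no_types, lifting) UN_least open_UN subset_antisym UNIV_I)
  then have openU: "open U"
    by (simp add: U_def immediate_basin_def B_def open_connected_component)
  have connU: "connected U"
    by (simp add: U_def immediate_basin_def)
  have UB: "U \<subseteq> B"
    by (simp add: U_def immediate_basin_def B_def connected_component_subset)
  \<comment> \<open>For an open connected planar set, simple connectivity amounts to vanishing
    winding numbers about all points outside it.\<close>
  have "winding_number g z = 0"
    if g: "path g" "path_image g \<subseteq> U" "pathfinish g = pathstart g" and z: "z \<notin> U" for g z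
  proof -
    define K where "K = path_image g \<union> inside (path_image g)"
    have clg: "closed (path_image g)" using g(1) by (rule closed_path_image)
    have K: "compact K"
      unfolding K_def compact_eq_bounded_closed
      using g(1) by (simp add: closed_path_image_Un_inside bounded_path_image bounded_inside)
    have "inside (path_image g) \<subseteq> interior K"
      by (intro interior_maximal open_inside clg) (auto simp: K_def)
    then have frK: "frontier K \<subseteq> path_image g"
      using closure_closed[OF compact_imp_closed[OF K]] unfolding frontier_def K_def by auto
    have KE: "K \<subseteq> E m" for m
    proof (induction m)
      case (Suc m)
      have cont: "continuous_on K (t ^^ m)"
        using contE Suc by (rule continuous_on_subset)
      have "a \<notin> (t ^^ m) ` K"
      proof
        assume a: "a \<in> (t ^^ m) ` K"
        have "bounded ((t ^^ m) ` K)"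
          using compact_continuous_image[OF cont K] by (rule compact_imp_bounded)
        then have "\<not> L \<subseteq> (t ^^ m) ` K" using L(2) bounded_subset by blast
        then have "L \<inter> frontier ((t ^^ m) ` K) \<noteq> {}"
          using a L by (intro connected_Int_frontier) auto
        moreover have "frontier ((t ^^ m) ` K) \<subseteq> (t ^^ m) ` frontier K"
          using E[of m] Suc interior_subset[of K]
          by (intro frontier_holomorphic_image_subset K cont) (auto intro: holomorphic_on_subset)
        moreover have "(t ^^ m) ` frontier K \<subseteq> B"
          using frK g(2) UB by (force simp: iterB)
        ultimately show False using L(4) by (auto simp: B_def)
      qed
      then show ?case using Suc by (auto simp: E_def less_Suc_eq)
    qed (simp add: E_def)
    \<comment> \<open>By compactness and monotonicity of \<open>C\<close>, a single iterate takes
      the whole loop into the ball.\<close>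
    obtain M where M: "path_image g \<subseteq> C M"
    proof -
      have "path_image g \<subseteq> (\<Union>m\<in>UNIV. C m)" using g(2) UB B_C by auto
      then obtain F where F: "finite F" "path_image g \<subseteq> (\<Union>m\<in>F. C m)"
        using compactE_image[OF compact_path_image[OF g(1)], of UNIV C] openC by metis
      have "C m \<subseteq> C (Max F)" if "m \<in> F" for m
        using C_mono F(1) that by auto
      with F(2) show thesis by (intro that[of "Max F"]) blast
    qed
    have "K \<subseteq> B"
    proof
      fix x assume x: "x \<in> K"
      have "norm ((t ^^ M) x - w\<^sub>0) \<le> r"
      proof (rule maximum_modulus_frontier[where S = K and f = "\<lambda>x. (t ^^ M) x - w\<^sub>0"])
        show "(\<lambda>x. (t ^^ M) x - w\<^sub>0) holomorphic_on interior K"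
          using E[of M] KE[of M] interior_subset[of K]
          by (intro holomorphic_on_diff holomorphic_on_const) (auto intro: holomorphic_on_subset)
        have "continuous_on K (t ^^ M)" using contE KE by (rule continuous_on_subset)
        then show "continuous_on (closure K) (\<lambda>x. (t ^^ M) x - w\<^sub>0)"
          using K by (auto simp: compact_imp_closed intro!: continuous_intros)
        show "norm ((t ^^ M) y - w\<^sub>0) \<le> r" if "y \<in> frontier K" for y
        proof -
          have "y \<in> C M" using that frK M by blast
          then show ?thesis by (auto simp: C_def dist_norm norm_minus_commute)
        qed
      qed (use K x in \<open>auto simp: compact_imp_bounded\<close>)
      then have "(t ^^ M) x \<in> B"
        using cballB by (auto simp: dist_norm norm_minus_commute)
      then show "x \<in> B" by (simp add: iterB)
    qed
    moreover have "connected K"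
      unfolding K_def using g(1) by (intro connected_with_inside clg connected_path_image)
    moreover have "pathstart g \<in> K" "pathstart g \<in> U"
      using g by (auto simp: K_def)
    \<comment> \<open>A connected subset of the basin that meets \<open>U\<close> lies in that
      component.\<close>
    ultimately have "K \<subseteq> U"
      unfolding U_def immediate_basin_def B_def
      by (metis connected_component_eq connected_component_maximal)
    with z have "z \<in> outside (path_image g)"
      by (auto simp: K_def union_with_inside)
    then show ?thesis
      using g by (intro winding_number_zero_in_outside) auto
  qed
  then have "simply_connected U"
    using openU connU by (simp add: simply_connected_eq_winding_number_zero)
  then show ?thesis by (simp add: U_def)
qed

section \<open>The model map for the roots of unity\<close>

locale unit_traub =
  fixes n :: nat and \<delta> :: real
  assumes n2: "n \<ge> 2" and \<delta>: "\<delta> \<in> {0..1}"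
begin

text \<open>
  \<open>N\<close> and \<open>t\<close> are the Newton and Traub maps of \<open>z ^ n - 1\<close>; division by zero makes the pole \<open>0\<close> of
  \<open>t\<close> a fixed point. They are polymorphic so that the real and complex maps share the definition.
\<close>

definition N :: "'a::real_normed_field \<Rightarrow> 'a" where
  "N z = z - (z ^ n - 1) / (of_nat n * z ^ (n - 1))"

definition t :: "'a::real_normed_field \<Rightarrow> 'a" where
  "t z = N z - of_real \<delta> * ((N z ^ n - 1) / (of_nat n * z ^ (n - 1)))"

lemma t_0: "t 0 = 0"
  using n2 by (simp add: t_def N_def power_0_left)

lemma N_1: "N 1 = 1" and t_1: "t 1 = 1"
  by (simp_all add: t_def N_def)

text \<open>Rotational symmetry: \<open>c ^ (n - 1)\<close> is the inverse of \<open>c\<close>, so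
  the Newton correction picks up exactly one factor \<open>c\<close>.\<close>

lemma N_mult_root_of_unity:
  assumes "c ^ n = 1"
  shows "N (c * z) = c * N z"
proof -
  have c: "c \<noteq> 0" using assms n2 by (cases "c = 0") (auto simp: power_0_left)
  have "c * c ^ (n - 1) = 1"
    using assms n2 by (cases n) auto
  then have "c ^ (n - 1) = inverse c" using c by (simp add: field_simps)
  then show ?thesis
    using assms by (simp add: N_def power_mult_distrib divide_inverse algebra_simps)
qed

lemma t_mult_root_of_unity:
  assumes "c ^ n = 1"
  shows "t (c * z) = c * t z"
proof -
  have c: "c \<noteq> 0" using assms n2 by (cases "c = 0") (auto simp: power_0_left)
  have "c * c ^ (n - 1) = 1"
    using assms n2 by (cases n) auto
  then have "c ^ (n - 1) = inverse c" using c by (simp add: field_simps)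
  then show ?thesis
    using assms by (simp add: t_def N_mult_root_of_unity power_mult_distrib divide_inverse algebra_simps)
qed

lemma t_cnj: "t (cnj z) = cnj (t z)"
  by (simp add: t_def N_def)

lemma t_of_real: "t (of_real x) = (of_real (t x) :: complex)"
  by (simp add: t_def N_def)

lemma N_holomorphic: "N holomorphic_on - {0}"
  unfolding N_def using n2 by (auto intro!: holomorphic_intros)

lemma t_holomorphic: "t holomorphic_on - {0}"
  unfolding t_def using n2 by (auto intro!: holomorphic_intros N_holomorphic)

lemma N_deriv_1: "(N has_field_derivative 0) (at (1::complex))"
  unfolding N_def using n2 by (auto intro!: derivative_eq_intros simp: field_simps)

text \<open>The added correction has derivative zero because \<open>N 1 = 1\<close> and
  \<open>N\<close> has derivative zero there; thus 1 is superattracting.\<close>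

lemma t_deriv_1: "(t has_field_derivative 0) (at (1::complex))"
  unfolding t_def using n2 N_deriv_1 by (auto intro!: derivative_eq_intros simp: N_1)

text \<open>
  The ray is fixed pointwise by the reflection \<open>\<sigma>\<close>, which commutes with \<^term>\<open>t\<close> and moves \<open>1\<close>.
\<close>

lemma basin_disjoint_ray:
  defines "\<zeta> \<equiv> cis (pi / of_nat n)"
  shows "(\<lambda>r. of_real r * \<zeta>) ` {0..} \<inter> basin t 1 = {}"
proof -
  define \<sigma> where "\<sigma> z = \<zeta>\<^sup>2 * cnj z" for z
  \<comment> \<open>\<open>\<zeta>\<^sup>2\<close> is \<open>cis (2 * pi / n)\<close>, so \<sigma>
    is conjugation followed by a rotational symmetry of \<open>t\<close>.\<close>
  have pw: "(\<zeta>\<^sup>2) ^ n = 1"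
  proof -
    have "(\<zeta>\<^sup>2) ^ n = cis (real (2 * n) * (pi / real n))"
      unfolding \<zeta>_def power_mult[symmetric] by (rule Complex.DeMoivre)
    also have "real (2 * n) * (pi / real n) = 2 * pi" using n2 by simp
    finally show ?thesis by simp
  qed
  have ne: "\<zeta>\<^sup>2 \<noteq> 1"
  proof
    assume "\<zeta>\<^sup>2 = 1"
    then have "\<zeta> = 1 \<or> \<zeta> = -1" by (simp add: power2_eq_1_iff)
    then have "sin (pi / n) = 0"
      by (auto simp: \<zeta>_def complex_eq_iff)
    moreover have "sin (pi / n) > 0"
      using n2 by (intro sin_gt_zero) (auto simp: field_simps)
    ultimately show False by simp
  qed
  have \<sigma>t: "(t ^^ m) (\<sigma> z) = \<sigma> ((t ^^ m) z)" for m z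
    by (induction m) (auto simp: \<sigma>_def t_mult_root_of_unity[OF pw] t_cnj)
  have False if "r \<ge> 0" "of_real r * \<zeta> \<in> basin t 1" for r
  proof -
    define w where "w = of_real r * \<zeta>"
    have "\<zeta>\<^sup>2 * cnj \<zeta> = \<zeta>"
      by (simp add: \<zeta>_def cis_cnj power2_eq_square cis_mult)
    then have "\<sigma> w = w"
      by (simp add: w_def \<sigma>_def mult.left_commute)
    have lim: "(\<lambda>m. (t ^^ m) w) \<longlonglongrightarrow> 1"
      using that by (simp add: basin_def w_def)
    then have "(\<lambda>m. \<sigma> ((t ^^ m) w)) \<longlonglongrightarrow> \<sigma> 1"
      unfolding \<sigma>_def by (intro tendsto_intros)
    then have "(\<lambda>m. (t ^^ m) w) \<longlonglongrightarrow> \<sigma> 1"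
      by (simp flip: \<sigma>t add: \<open>\<sigma> w = w\<close>)
    with lim have "\<sigma> 1 = 1" using LIMSEQ_unique by blast
    with ne show False by (simp add: \<sigma>_def)
  qed
  then show ?thesis by auto
qed

lemma simply_connected_basin: "simply_connected (immediate_basin t (1::complex))"
proof (rule immediate_basin_simply_connected)
  define \<zeta> where "\<zeta> = cis (pi / of_nat n)"
  let ?L = "(\<lambda>r. of_real r * \<zeta>) ` {0..}"
  show "connected ?L"
    by (intro connected_continuous_image continuous_intros) auto
  show "\<not> bounded ?L"
  proof
    assume "bounded ?L"
    then obtain b where "b > 0" "\<And>x. x \<in> ?L \<Longrightarrow> norm x \<le> b"
      unfolding bounded_pos by blast
    then have "norm (of_real (b + 1) * \<zeta>) \<le> b" by (metis add_nonneg_nonneg atLeast_iff imageI less_imp_le zero_le_one)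
    then show False using \<open>b > 0\<close> by (simp add: \<zeta>_def norm_mult del: of_real_add)
  qed
  show "?L \<inter> basin t 1 = {}"
    unfolding \<zeta>_def by (rule basin_disjoint_ray)
  show "0 \<in> ?L" by (rule image_eqI[of _ _ 0]) auto
qed (use t_holomorphic t_1 t_deriv_1 in auto)

text \<open>By convexity \<open>x ^ n - 1\<close> lies above its tangents, so a Newton step from the
  right cannot overshoot the root 1. Bernoulli's inequality at \<open>1 / x - 1\<close> is this
  tangent bound.\<close>

lemma N_bounds:
  fixes x :: real
  assumes "x \<ge> 1"
  shows "1 \<le> N x" "N x \<le> x"
proof -
  have x: "x ^ n = x * x ^ (n - 1)" using n2 by (cases n) auto
  have pos: "real n * x ^ (n - 1) > 0" using assms n2 by simp
  have "1 + real n * (1 / x - 1) \<le> (1 + (1 / x - 1)) ^ n"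
    using assms by (intro Bernoulli_inequality) auto
  then have "1 + real n * (1 / x - 1) \<le> 1 / x ^ n"
    by (simp add: power_one_over)
  then have "(1 + real n * (1 / x - 1)) * x ^ n \<le> 1"
    using assms by (simp add: pos_le_divide_eq)
  moreover have "(1 + real n * (1 / x - 1)) * x ^ n = x ^ n - real n * x ^ (n - 1) * (x - 1)"
    using assms unfolding x by (simp add: field_simps)
  ultimately have "x ^ n - 1 \<le> (x - 1) * (real n * x ^ (n - 1))"
    by (simp add: mult_ac)
  then have "(x ^ n - 1) / (real n * x ^ (n - 1)) \<le> x - 1"
    using pos by (simp only: pos_divide_le_eq)
  then show "1 \<le> N x" by (simp add: N_def)
  have "1 \<le> x ^ n" using assms by simp
  then show "N x \<le> x" using pos by (simp add: N_def)
qed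

text \<open>Since \<^term>\<open>N x \<le> x\<close>, the Traub correction is at most a Newton step from \<^term>\<open>N x\<close>.\<close>

lemma t_bounds:
  fixes x :: real
  assumes x: "x \<ge> 1"
  shows "1 \<le> t x" "t x \<le> N x"
proof -
  have y: "1 \<le> N x" "N x \<le> x" using N_bounds[OF x] by auto
  define q where "q = (N x ^ n - 1) / (real n * x ^ (n - 1))"
  have "N x ^ n \<ge> 1" using y by simp
  then have q0: "q \<ge> 0" using x by (simp add: q_def)
  \<comment> \<open>Replacing \<open>x\<close> by the smaller \<open>N x\<close> in the denominator
    turns \<open>q\<close> into a full Newton step.\<close>
  have "q \<le> (N x ^ n - 1) / (real n * N x ^ (n - 1))"
    unfolding q_def using y n2 \<open>N x ^ n \<ge> 1\<close>
    by (intro divide_left_mono mult_left_mono power_mono mult_pos_pos) auto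
  also have "\<dots> = N x - N (N x)" by (simp add: N_def[of "N x"])
  also have "\<dots> \<le> N x - 1" using N_bounds[OF y(1)] by simp
  finally have "q \<le> N x - 1" .
  moreover have "0 \<le> \<delta> * q" "\<delta> * q \<le> q"
    using \<delta> q0 by (auto intro: mult_left_le_one_le)
  ultimately show "1 \<le> t x" "t x \<le> N x"
    by (auto simp: t_def q_def)
qed

text \<open>The orbit decreases and is bounded below by 1. Its limit satisfies
  \<open>l \<le> N l\<close>, because each term is at most the Newton image of the previous one, and
  this forces \<open>l ^ n \<le> 1\<close>.\<close>

lemma real_ray_in_basin:
  fixes x :: real
  assumes "x \<ge> 1"
  shows "x \<in> basin t 1"
proof -
  define X where "X m = (t ^^ m) x" for m
  have X_Suc: "X (Suc m) = t (X m)" for m by (simp add: X_def)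
  have X1: "X m \<ge> 1" for m
  proof (induction m)
    case 0
    show ?case using assms by (simp add: X_def)
  next
    case (Suc m)
    then show ?case using t_bounds(1)[of "X m"] by (simp only: X_Suc)
  qed
  have "X (Suc m) \<le> X m" for m
    unfolding X_Suc using t_bounds(2)[OF X1, of m] N_bounds(2)[OF X1, of m] by linarith
  then have "decseq X" by (rule decseq_SucI)
  then obtain l where l: "X \<longlonglongrightarrow> l"
    using decseq_convergent[of X 1] X1 by blast
  have l1: "l \<ge> 1" using X1 by (intro LIMSEQ_le_const[OF l]) auto
  have "(\<lambda>m. N (X m)) \<longlonglongrightarrow> N l"
    unfolding N_def using l1 n2 by (intro tendsto_intros l) auto
  then have "l \<le> N l"
    by (rule LIMSEQ_le[OF LIMSEQ_Suc[OF l]]) (use X1 t_bounds in \<open>auto simp: X_Suc\<close>)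
  then have "(l ^ n - 1) / (real n * l ^ (n - 1)) \<le> 0" by (simp add: N_def)
  moreover have "real n * l ^ (n - 1) > 0" using l1 n2 by simp
  ultimately have "l ^ n \<le> 1" by (simp add: divide_le_0_iff)
  then have "l = 1"
    using l1 n2 by (metis antisym_conv2 not_le one_less_power less_le_trans zero_less_numeral)
  with l show ?thesis by (simp add: basin_def X_def[abs_def])
qed

lemma complex_ray_in_basin:
  fixes x :: real
  assumes "x \<ge> 1"
  shows "complex_of_real x \<in> basin t 1"
proof -
  have "(t ^^ m) (complex_of_real x) = of_real ((t ^^ m) x)" for m
    by (induction m) (auto simp: t_of_real)
  moreover have "(\<lambda>m. complex_of_real ((t ^^ m) x)) \<longlonglongrightarrow> of_real 1"
    using real_ray_in_basin[OF assms] by (intro tendsto_of_real) (simp add: basin_def)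
  ultimately show ?thesis by (simp add: basin_def)
qed

text \<open>The half-line from 1 to the right is connected and lies in the basin, hence in the
  component of 1.\<close>

lemma unbounded_basin: "\<not> bounded (immediate_basin t (1::complex))"
proof
  assume "bounded (immediate_basin t (1::complex))"
  moreover have "complex_of_real ` {1..} \<subseteq> immediate_basin t 1"
    unfolding immediate_basin_def
    by (intro connected_component_maximal connected_continuous_image continuous_intros)
      (auto intro: complex_ray_in_basin image_eqI[of _ _ 1])
  ultimately have "bounded (complex_of_real ` {1..})"
    using bounded_subset by blast
  then obtain b where "\<And>x. x \<ge> 1 \<Longrightarrow> norm (complex_of_real x) \<le> b"
    unfolding bounded_iff by auto
  from this[of "max 1 (b + 1)"] show False by auto
qed

end

section \<open>Affine normalisation and the two families of polynomials\<close>

lemma unbounded_in_plane_affine_image: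
  assumes "\<not> bounded U" "s \<noteq> 0"
  shows "unbounded_in_plane ((Some \<circ> (\<lambda>w. m + s * w)) ` U)"
proof -
  have eq: "{z. Some z \<in> (Some \<circ> (\<lambda>w. m + s * w)) ` U} = (\<lambda>w. m + s * w) ` U"
    by auto
  have "bounded U" if bd: "bounded ((\<lambda>w. m + s * w) ` U)"
  proof -
    obtain b where "\<forall>z\<in>(\<lambda>w. m + s * w) ` U. norm z \<le> b"
      using bd unfolding bounded_iff by blast
    then have b: "norm (m + s * w) \<le> b" if "w \<in> U" for w
      using that by blast
    have "norm w \<le> (b + norm m) / norm s" if "w \<in> U" for w
    proof -
      have "norm (s * w) \<le> norm (m + s * w) + norm m"
        by (metis add_diff_cancel_left' norm_triangle_ineq4)
      with b[OF that] have "norm s * norm w \<le> b + norm m" by (simp add: norm_mult)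
      then show ?thesis using \<open>s \<noteq> 0\<close> by (simp add: field_simps)
    qed
    then show ?thesis unfolding bounded_iff by blast
  qed
  with assms show ?thesis
    unfolding unbounded_in_plane_def eq by blast
qed

lemma homeomorphism_affine:
  fixes s :: complex
  assumes "s \<noteq> 0"
  shows "homeomorphism UNIV UNIV (\<lambda>w. m + s * w) (\<lambda>z. (z - m) / s)"
proof (rule homeomorphismI)
  show "continuous_on UNIV (\<lambda>w. m + s * w)" "continuous_on UNIV (\<lambda>z. (z - m) / s)"
    using assms by (intro continuous_intros; simp)+
qed (use assms in \<open>auto simp: field_simps\<close>)

text \<open>The affine map \<phi> conjugates the Traub map to the model map \<open>t\<close>, and
  the factor \<open>c\<close> cancels. At \<open>w = 0\<close> the spherical map has a pole while
  \<open>t\<close> has its artificial fixed point, which differs from 1.\<close>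

lemma immediate_basin_traub_unity_roots:
  fixes p :: "complex poly"
  assumes d: "degree p \<ge> 2" and \<delta>: "\<delta> \<in> {0..1}"
    and p: "\<And>w. poly p (m + s * w) = c * (w ^ n - 1)"
    and nz: "s \<noteq> 0" "c \<noteq> 0" "n \<ge> 2"
  defines "A \<equiv> immediate_basin (traub_map p (of_real \<delta>)) (Some (m + s))"
  shows "simply_connected A \<and> unbounded_in_plane A"
proof -
  interpret unit_traub n \<delta> by unfold_locales fact+
  define \<phi> where "\<phi> = (\<lambda>w. m + s * w)"
  \<comment> \<open>Differentiating \<open>poly p (\<phi> w)\<close> in two ways gives the
    derivative of \<open>p\<close> in the new coordinate.\<close>
  have p': "poly (pderiv p) (\<phi> w) = c * (of_nat n * w ^ (n - 1)) / s" for w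
  proof -
    have "((\<lambda>w. poly p (\<phi> w)) has_field_derivative poly (pderiv p) (\<phi> w) * s) (at w)"
      unfolding \<phi>_def by (auto intro!: derivative_eq_intros poly_DERIV DERIV_chain2[of "poly p"])
    moreover have "((\<lambda>w. poly p (\<phi> w)) has_field_derivative c * (of_nat n * w ^ (n - 1))) (at w)"
      unfolding \<phi>_def p by (auto intro!: derivative_eq_intros)
    ultimately have "poly (pderiv p) (\<phi> w) * s = c * (of_nat n * w ^ (n - 1))"
      by (rule DERIV_unique)
    then show ?thesis using nz by (simp add: field_simps)
  qed
  have step: "traub_map p (of_real \<delta>) (Some (\<phi> w)) = Some (\<phi> (t w)) \<or>
      traub_map p (of_real \<delta>) (Some (\<phi> w)) = None \<and> t w = w \<and> w \<noteq> 1" for w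
  proof (cases "w = 0")
    case True
    have "traub_map p (of_real \<delta>) (Some (\<phi> 0)) = None"
    proof (rule traub_map_pole[OF d])
      show "poly (pderiv p) (\<phi> 0) = 0" using nz by (simp add: p')
      show "poly p (\<phi> 0) \<noteq> 0" using nz p[of 0] by (simp add: \<phi>_def power_0_left)
    qed
    then show ?thesis using True t_0 by simp
  next
    case False
    define D where "D = of_nat n * w ^ (n - 1)"
    have D: "D \<noteq> 0" using False nz by (simp add: D_def)
    have p'w: "poly (pderiv p) (\<phi> w) = c * D / s" by (simp add: p' D_def)
    have N: "\<phi> w - poly p (\<phi> w) / poly (pderiv p) (\<phi> w) = \<phi> (N w)"
      unfolding p'w using D nz unfolding \<phi>_def p N_def D_def[symmetric] by (simp add: field_simps)
    have "traub_map p (of_real \<delta>) (Some (\<phi> w)) = Some (\<phi> (N w) - of_real \<delta> * (poly p (\<phi> (N w)) / (c * D / s)))"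
      using traub_map_eq[of p "\<phi> w" "of_real \<delta>", unfolded N, unfolded p'w] D nz by simp
    also have "\<phi> (N w) - of_real \<delta> * (poly p (\<phi> (N w)) / (c * D / s)) = \<phi> (t w)"
      using D nz unfolding t_def D_def[symmetric] unfolding \<phi>_def p by (simp add: field_simps)
    finally show ?thesis by simp
  qed
  have inf: "traub_map p (of_real \<delta>) None = None"
    by (rule traub_map_infinity[OF d \<delta>])
  have "1 \<in> basin t (1::complex)"
    using complex_ray_in_basin[of 1] by simp
  note * = immediate_basin_sphere[OF homeomorphism_affine[OF nz(1), of m, folded \<phi>_def] inf step this]
  have "\<phi> 1 = m + s" by (simp add: \<phi>_def)
  then have "simply_connected A" "A = (Some \<circ> \<phi>) ` immediate_basin t 1"
    using * simply_connected_basin by (auto simp: A_def)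
  with unbounded_in_plane_affine_image[OF unbounded_basin nz(1), of m] show ?thesis
    by (simp add: \<phi>_def)
qed

text \<open>In the coordinate centred at \<alpha> the map is multiplication by a real
  \<open>k\<close> with \<open>0 \<le> k < 1\<close>, so the planar basin is the whole
  plane.\<close>

lemma immediate_basin_traub_power:
  fixes c \<alpha> :: complex and \<delta> :: real and n :: nat
  assumes c: "c \<noteq> 0" and n: "n \<ge> 2" and \<delta>: "\<delta> \<in> {0..1}"
  defines "A \<equiv> immediate_basin (traub_map (smult c ([:- \<alpha>, 1:] ^ n)) (of_real \<delta>)) (Some \<alpha>)"
  shows "simply_connected A \<and> unbounded_in_plane A"
proof -
  define l where "l = 1 - 1 / real n"
  define k where "k = l - \<delta> * (l ^ n / real n)"
  have l: "0 \<le> l" "l < 1" using n by (auto simp: l_def)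
  have "0 \<le> l ^ n / n" using l by simp
  \<comment> \<open>This keeps \<open>k\<close> nonnegative for every \<delta> up to 1.\<close>
  moreover have "l ^ n / n \<le> l"
  proof -
    have "l ^ n / n \<le> l ^ n" using l n by (simp add: divide_le_eq mult_le_cancel_left1)
    also have "l ^ n \<le> l ^ 1" using l n by (intro power_decreasing) auto
    finally show ?thesis by simp
  qed
  moreover have "\<delta> * (l ^ n / n) \<le> l ^ n / n" "0 \<le> \<delta> * (l ^ n / n)"
    using \<delta> \<open>0 \<le> l ^ n / n\<close> by (auto intro!: mult_left_le_one_le simp del: times_divide_eq_right)
  ultimately have k: "0 \<le> k" "k < 1" using l by (auto simp: k_def)
  define t where "t = (\<lambda>w :: complex. of_real k * w)"
  have t_iter: "(t ^^ m) w = of_real k ^ m * w" for m w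
    by (induction m) (auto simp: t_def)
  have "(\<lambda>m. of_real k ^ m * w) \<longlonglongrightarrow> 0" for w :: complex
    using k by (intro tendsto_mult_left_zero LIMSEQ_power_zero) auto
  then have basin: "basin t 0 = UNIV"
    by (auto simp: basin_def t_iter)
  then have ib: "immediate_basin t 0 = UNIV"
    by (simp add: immediate_basin_def connected_component_UNIV)
  let ?p = "smult c ([:- \<alpha>, 1:] ^ n)"
  have step: "traub_map ?p (of_real \<delta>) (Some (\<alpha> + 1 * w)) = Some (\<alpha> + 1 * t w) \<or>
     traub_map ?p (of_real \<delta>) (Some (\<alpha> + 1 * w)) = None \<and> t w = w \<and> w \<noteq> 0" for w
    using traub_map_power[OF c, of n \<alpha> "of_real \<delta>" w] n by (simp add: t_def k_def l_def)
  have inf: "traub_map ?p (of_real \<delta>) None = None"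
    by (rule traub_map_infinity[OF _ \<delta>]) (use n c in \<open>simp add: degree_power_eq\<close>)
  have "0 \<in> basin t 0" by (simp add: basin)
  note * = immediate_basin_sphere[OF homeomorphism_affine[OF one_neq_zero] inf step this]
  have "A = (Some \<circ> (\<lambda>w. \<alpha> + 1 * w)) ` UNIV"
    using *(1) unfolding A_def ib by simp
  moreover have "simply_connected A"
    using *(2) unfolding A_def ib by (simp add: convex_imp_simply_connected)
  ultimately show ?thesis
    using unbounded_in_plane_affine_image[OF not_bounded_UNIV one_neq_zero, of \<alpha>] by simp
qed

theorem theoremA:
  fixes p :: "complex poly" and \<alpha> :: complex and \<delta> :: real
  assumes "degree p \<ge> 2"
    and "degree p = 2 \<or> (\<exists>n \<beta>. n \<ge> 3 \<and> p = monom 1 n - [:\<beta>:])"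
    and "poly p \<alpha> = 0"
    and "\<delta> \<in> {0..1}"
  shows "simply_connected (immediate_basin (traub_map p (of_real \<delta>)) (Some \<alpha>))
    \<and> unbounded_in_plane (immediate_basin (traub_map p (of_real \<delta>)) (Some \<alpha>))"
  using assms(2)
proof (elim disjE exE conjE)
  assume "degree p = 2"
  obtain q where q: "p = [:- \<alpha>, 1:] * q"
    using assms(3) by (auto simp: poly_eq_0_iff_dvd elim: dvdE)
  then have "q \<noteq> 0" using \<open>degree p = 2\<close> by auto
  then have "degree q = 1"
    using \<open>degree p = 2\<close> unfolding q by (subst (asm) degree_mult_eq) auto
  then obtain a b where ab: "q = [:b, a:]" "a \<noteq> 0"
    by (cases q) (auto elim!: degree_eq_zeroE split: if_splits)
  \<comment> \<open>The second root of the quadratic.\<close>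
  define r where "r = - b / a"
  have p: "p = smult a ([:- \<alpha>, 1:] * [:- r, 1:])"
    using ab by (simp add: q r_def algebra_simps)
  show ?thesis
  proof (cases "r = \<alpha>")
    case True
    then have "p = smult a ([:- \<alpha>, 1:] ^ 2)"
      unfolding p by (simp only: power2_eq_square)
    then show ?thesis
      using immediate_basin_traub_power[OF ab(2) _ assms(4), of 2 \<alpha>] by simp
  next
    case False
    \<comment> \<open>Midpoint and half-difference of the roots: \<open>w = 1\<close> and
      \<open>w = -1\<close> go to \<alpha> and \<open>r\<close>.\<close>
    define m s where "m = (\<alpha> + r) / 2" and "s = (\<alpha> - r) / 2"
    have ms: "m + s = \<alpha>" "r = m - s" by (auto simp: m_def s_def field_simps)
    have "poly p (m + s * w) = (a * s\<^sup>2) * (w ^ 2 - 1)" for w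
      by (simp add: p ms(2) flip: ms(1)) (simp add: algebra_simps power2_eq_square)
    moreover have "s \<noteq> 0" using False by (simp add: s_def)
    ultimately show ?thesis
      using immediate_basin_traub_unity_roots[OF assms(1,4), of m s "a * s\<^sup>2" 2] ab(2) ms(1) by simp
  qed
next
  fix n \<beta>
  assume n: "n \<ge> (3::nat)" and p: "p = monom 1 n - [:\<beta>:]"
  have \<beta>: "\<beta> = \<alpha> ^ n" using assms(3) by (simp add: p poly_monom)
  show ?thesis
  proof (cases "\<alpha> = 0")
    case True
    \<comment> \<open>A root at 0 forces \<beta> = 0, so \<open>p\<close> is a pure power.\<close>
    then have "p = smult 1 ([:- \<alpha>, 1:] ^ n)"
      using n \<beta> by (simp add: p power_0_left monom_altdef)
    then show ?thesis
      using immediate_basin_traub_power[of 1 n \<delta> \<alpha>] n assms(4) by simp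
  next
    case False
    \<comment> \<open>Scaling by \<alpha> itself, a chosen root, sends 1 to \<alpha>.\<close>
    have "poly p (0 + \<alpha> * w) = \<beta> * (w ^ n - 1)" for w
      by (simp add: p \<beta> poly_monom power_mult_distrib algebra_simps)
    then show ?thesis
      using immediate_basin_traub_unity_roots[OF assms(1,4), of 0 \<alpha> \<beta> n] False n \<beta> by simp
  qed
qed

end
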